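(* Let $a_1, \dots, a_n$ be real numbers with $a_i \geq 1$ for all $i$. Let $S_0 = n$, $S_1 = \sum_{i=1}^n a_i$ and $S^* = \sum_{i=1}^n \binom{a_i}{2}$. Suppose that $B$ and $\epsilon$ are real numbers with $B > 0$ and $\epsilon \geq 0$ such that $S_1 = B + \epsilon$, and let $C = 2S^* + B$. Then \[ S_0 C - B^2 \geq 0. \]
   Context: For a real number $a$, $\binom{a}{2}$ denotes $a(a-1)/2$. For real numbers $a_1,\dots,a_n$ and $j = 0,1,2,\dots$, the notation is $S_j = \sum_{i=1}^n a_i^j$, so that $S_0 = n$, $S_1$ is the sum of the $a_i$ and $S_2$ is the sum of the squares $a_i^2$; also $S^* = \sum_{i=1}^n \binom{a_i}{2}$, so that $S_2 = 2S^* + S_1$. *)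

theory Defs
  imports Complex_Main
begin

(* a 1, ..., a n are the n real numbers; values of a outside {1..n} are irrelevant. *)

definition power_sum :: "nat \<Rightarrow> (nat \<Rightarrow> real) \<Rightarrow> nat \<Rightarrow> real" where
  "power_sum n a j = (\<Sum>i=1..n. a i ^ j)"

definition binom_sum :: "nat \<Rightarrow> (nat \<Rightarrow> real) \<Rightarrow> real" where
  "binom_sum n a = (\<Sum>i=1..n. a i gchoose 2)"

lemma gchoose_two_real: "(x::real) gchoose 2 = x * (x - 1) / 2"
  by (simp add: gbinomial_prod_rev numeral_2_eq_2)

lemma power_sum_0: "power_sum n a 0 = real n"
  by (simp add: power_sum_def)

lemma power_sum_2: "power_sum n a 2 = 2 * binom_sum n a + power_sum n a 1"
  by (simp add: power_sum_def binom_sum_def gchoose_two_real sum_distrib_left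
      sum.distrib [symmetric] power2_eq_square field_simps)

end

theory Submission
  imports Defs "HOL-Analysis.Convex"
begin

text \<open>Since \<open>S\<^sub>2 = 2 S\<^sup>* + S\<^sub>1\<close>, one has \<open>C = S\<^sub>2 - \<epsilon>\<close>, and substituting \<open>B = S\<^sub>1 - \<epsilon>\<close> gives
  \<open>S\<^sub>0 C - B\<^sup>2 = (S\<^sub>0 S\<^sub>2 - S\<^sub>1\<^sup>2) + \<epsilon> ((S\<^sub>1 - S\<^sub>0) + B)\<close>.
  The first bracket is nonnegative by Cauchy--Schwarz. In the second, \<open>S\<^sub>1 \<ge> S\<^sub>0\<close> because each
  \<open>a\<^sub>i\<close> is at least 1, and \<open>B\<close> is positive.\<close>

theorem theorem1p3:
  fixes n :: nat and a :: "nat \<Rightarrow> real" and B C \<epsilon> :: real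
  assumes "\<And>i. i \<in> {1..n} \<Longrightarrow> a i \<ge> 1"
    and "B > 0" and "\<epsilon> \<ge> 0"
    and "power_sum n a 1 = B + \<epsilon>"
    and "C = 2 * binom_sum n a + B"
  shows "power_sum n a 0 * C - B\<^sup>2 \<ge> 0"
proof -
  define S0 S1 S2 where "S0 = power_sum n a 0" and "S1 = power_sum n a 1" and "S2 = power_sum n a 2"
  have cauchy_schwarz: "S1\<^sup>2 \<le> S0 * S2"
    using sum_squared_le_sum_of_squares[of a "{1..n}"]
    by (simp add: S0_def S1_def S2_def power_sum_def mult.commute)
  have "S0 \<le> S1"
    unfolding S0_def S1_def power_sum_def using assms(1) by (intro sum_mono) simp
  then have linear_part: "0 \<le> \<epsilon> * ((S1 - S0) + B)"
    using assms(2,3) by simp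
  have B: "B = S1 - \<epsilon>" and C: "C = S2 - \<epsilon>"
    using assms(4,5) power_sum_2[of n a] by (simp_all add: S1_def S2_def)
  have "S0 * C - B\<^sup>2 = (S0 * S2 - S1\<^sup>2) + \<epsilon> * ((S1 - S0) + B)"
    unfolding B C by (simp add: power2_eq_square algebra_simps)
  then show ?thesis
    using cauchy_schwarz linear_part by (simp add: S0_def)
qed

end
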